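(* Let $G$ be a graph with a distinguished vertex $v$, and write $$y_{G:v}=\sum_{|\lambda|+b=|G|}c_{(\lambda,b)}e_{(\lambda,b)},$$ where the sum is over pairs of a partition $\lambda$ and a positive integer $b$. For a positive integer $j$, let $\mathrm{sink}_v(G,j)$ be the number of acyclic orientations of $G$ with exactly $j$ sinks, one of which is $v$. Then $$\mathrm{sink}_v(G,j)=\sum_{\substack{|\lambda|+b=|G|\\ \ell(\lambda)+1=j}}c_{(\lambda,b)}\,\lambda!\,(b-1)!.$$
   Context: All graphs are finite and simple with nonempty vertex set; $|G|$ is the number of vertices. For a partition $\lambda=(\lambda_1,\dots,\lambda_\ell)$ (possibly empty), $\ell(\lambda)=\ell$ is its number of parts, $|\lambda|=\lambda_1+\cdots+\lambda_\ell$ and $\lambda!=\lambda_1!\cdots\lambda_\ell!$ (with $\emptyset!=1$). A sink of an orientation is a vertex with no outgoing edges (isolated vertices are sinks). A labelled graph on $d$ vertices is a graph with vertex set $[d]=\{1,\dots,d\}$. For a set partition $\pi$ of $[d]$, let $B_{\pi,i}$ be the block containing $i$, and let $e_\pi=\sum x_{i_1}\cdots x_{i_d}$ in noncommuting variables $x_1,x_2,\dots$, summed over all tuples $(i_1,\dots,i_d)$ of positive integers with $i_j\ne i_k$ whenever $j\neq k$ and $B_{\pi,j}=B_{\pi,k}$. The $e_\pi$, over set partitions $\pi$ of $[d]$, form a $\mathbb Q$-basis of $\mathrm{NCSym}^d$, the degree-$d$ part of the algebra of symmetric functions in noncommuting variables. For $d\ge 1$ let $\mathrm{type}(\pi)=(\lambda,b)$,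 where $b=|B_{\pi,d}|$ and $\lambda$ is the integer partition (possibly empty) formed by the sizes of the other blocks. $\mathrm{UBCSym}^d$ is the $\mathbb Q$-vector space with basis $\{e_{(\lambda,b)}\}$ over pairs of a partition $\lambda$ and an integer $b\ge 1$ with $|\lambda|+b=d$, and $\nu:\mathrm{NCSym}^d\to\mathrm{UBCSym}^d$ is the linear map with $\nu(e_\pi)=e_{\mathrm{type}(\pi)}$. For a labelled graph $G$ on $d$ vertices, $Y_G=\sum_\kappa x_{\kappa(1)}\cdots x_{\kappa(d)}\in\mathrm{NCSym}^d$, summed over all proper colourings $\kappa:[d]\to\mathbb Z_{>0}$ of $G$, and $y_G=\nu(Y_G)$. For a graph $G$ on $d$ vertices with distinguished vertex $v$, $y_{G:v}=y_{G'}$ where $G'$ is any labelling of $G$ by $[d]$ in which $v$ has label $d$ (this does not depend on the choice of such labelling). *)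

theory Defs
  imports
    Complex_Main
    "HOL-Library.Disjoint_Sets"
    "HOL-Library.FuncSet"
    "HOL-Library.Function_Algebras"
    "HOL-Library.Multiset"
begin

section \<open>Graphs, colourings and orientations\<close>

text \<open>A graph is given by its vertex set and its set of edges, each edge being a
  two-element set of vertices.\<close>

definition simple_graph :: "'a set \<Rightarrow> 'a set set \<Rightarrow> bool" where
  "simple_graph V E \<longleftrightarrow>
     finite V \<and> V \<noteq> {} \<and> (\<forall>e\<in>E. \<exists>u w. e = {u, w} \<and> u \<in> V \<and> w \<in> V \<and> u \<noteq> w)"

definition proper_colourings :: "'a set \<Rightarrow> 'a set set \<Rightarrow> ('a \<Rightarrow> nat) set" where
  "proper_colourings V E =
     {\<kappa> \<in> V \<rightarrow>\<^sub>E {0<..}. \<forall>u w. {u, w} \<in> E \<longrightarrow> \<kappa> u \<noteq> \<kappa> w}"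

text \<open>An orientation is a set of arcs; the arc \<open>(u, w)\<close> points from \<open>u\<close> to \<open>w\<close>.\<close>

definition orientation :: "'a set set \<Rightarrow> 'a rel \<Rightarrow> bool" where
  "orientation E A \<longleftrightarrow>
     (\<forall>(u, w)\<in>A. {u, w} \<in> E) \<and>
     (\<forall>u w. {u, w} \<in> E \<longrightarrow> ((u, w) \<in> A) \<noteq> ((w, u) \<in> A))"

definition sinks :: "'a set \<Rightarrow> 'a rel \<Rightarrow> 'a set" where
  "sinks V A = {u \<in> V. \<forall>w. (u, w) \<notin> A}"

definition sink_at :: "'a set \<Rightarrow> 'a set set \<Rightarrow> 'a \<Rightarrow> nat \<Rightarrow> nat" where
  "sink_at V E v j =
     card {A. orientation E A \<and> acyclic A \<and> card (sinks V A) = j \<and> v \<in> sinks V A}"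

definition rooted_labelling :: "'a set \<Rightarrow> 'a \<Rightarrow> ('a \<Rightarrow> nat) \<Rightarrow> bool" where
  "rooted_labelling V v f \<longleftrightarrow> bij_betw f V {1..card V} \<and> f v = card V"


section \<open>Symmetric functions in noncommuting variables\<close>

text \<open>A formal power series in noncommuting variables \<open>x\<^sub>1, x\<^sub>2, \<dots>\<close> is the function taking
  each word over the positive integers to its coefficient; the word
  \<open>[i\<^sub>1, \<dots>, i\<^sub>d]\<close> stands for the monomial \<open>x\<^bsub>i\<^sub>1\<^esub> \<cdots> x\<^bsub>i\<^sub>d\<^esub>\<close>. Vectors in the \<open>\<rat>\<close>-space
  with the formal basis \<open>e\<^bsub>(\<lambda>, b)\<^esub>\<close> are likewise coefficient functions, so that one
  pointwise scalar multiplication serves both spaces.\<close>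

type_synonym ncseries = "nat list \<Rightarrow> rat"
type_synonym ubc = "nat multiset \<times> nat \<Rightarrow> rat"

definition fscale :: "rat \<Rightarrow> ('i \<Rightarrow> rat) \<Rightarrow> 'i \<Rightarrow> rat" where
  "fscale c f = (\<lambda>i. c * f i)"

interpretation fvec: vector_space "fscale :: rat \<Rightarrow> ('i \<Rightarrow> rat) \<Rightarrow> 'i \<Rightarrow> rat"
  by unfold_locales (auto simp: fscale_def fun_eq_iff algebra_simps)

definition block :: "nat set set \<Rightarrow> nat \<Rightarrow> nat set" where
  "block P i = (THE B. B \<in> P \<and> i \<in> B)"

text \<open>The tuple \<open>(i\<^sub>1, \<dots>, i\<^sub>d)\<close> is a list indexed from 0, hence the shift in \<open>w ! (j - 1)\<close>.\<close>

definition e_nc :: "nat \<Rightarrow> nat set set \<Rightarrow> ncseries" where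
  "e_nc d P = (\<lambda>w.
     if length w = d \<and> set w \<subseteq> {0<..} \<and>
        (\<forall>j\<in>{1..d}. \<forall>k\<in>{1..d}. j \<noteq> k \<and> block P j = block P k \<longrightarrow> w ! (j - 1) \<noteq> w ! (k - 1))
     then 1 else 0)"

definition set_partitions :: "nat \<Rightarrow> nat set set set" where
  "set_partitions d = {P. partition_on {1..d} P}"

definition chromatic_nc :: "nat \<Rightarrow> nat set set \<Rightarrow> ncseries" where
  "chromatic_nc d E = (\<lambda>w.
     of_nat (card {\<kappa> \<in> proper_colourings {1..d} E. map \<kappa> [1..<Suc d] = w}))"


section \<open>The space with basis indexed by pairs of a partition and a positive integer\<close>

definition ub_indices :: "nat \<Rightarrow> (nat multiset \<times> nat) set" where
  "ub_indices d = {(l, b). 0 \<notin># l \<and> 0 < b \<and> sum_mset l + b = d}"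

definition e_ub :: "nat multiset \<times> nat \<Rightarrow> ubc" where
  "e_ub p = (\<lambda>q. if q = p then 1 else 0)"

definition partition_type :: "nat \<Rightarrow> nat set set \<Rightarrow> nat multiset \<times> nat" where
  "partition_type d P =
     (image_mset card (mset_set (P - {block P d})), card (block P d))"

text \<open>The linear map with \<open>e_nc d P \<mapsto> e_ub (partition_type d P)\<close>: expand the argument
  in the basis \<open>e_nc d ` set_partitions d\<close> of its span (the homogeneous symmetric
  functions of degree \<open>d\<close>), and map the basis elements. The constant
  \<open>fvec.representation\<close> is the coordinate function of the library, which returns 0
  outside that span.\<close>

definition nu :: "nat \<Rightarrow> ncseries \<Rightarrow> ubc" where
  "nu d F = (\<Sum>P\<in>set_partitions d.
     fscale (fvec.representation (e_nc d ` set_partitions d) F (e_nc d P))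
            (e_ub (partition_type d P)))"

definition y_labelled :: "nat \<Rightarrow> nat set set \<Rightarrow> ubc" where
  "y_labelled d E = nu d (chromatic_nc d E)"

definition mfact :: "nat multiset \<Rightarrow> nat" where
  "mfact l = prod_mset (image_mset fact l)"


section \<open>Coordinates exist\<close>

lemma size_le_sum_mset: "0 \<notin># l \<Longrightarrow> size l \<le> sum_mset l" for l :: "nat multiset"
  by (induction l) auto

lemma finite_ub_indices: "finite (ub_indices d)"
proof -
  let ?M = "mset ` {xs. set xs \<subseteq> {..d} \<and> length xs \<le> d}"
  have "ub_indices d \<subseteq> ?M \<times> {..d}"
  proof
    fix p assume "p \<in> ub_indices d"
    then obtain l b where p: "p = (l, b)" "0 \<notin># l" "sum_mset l + b = d"
      by (auto simp: ub_indices_def)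
    obtain xs where xs: "mset xs = l" using ex_mset by blast
    have "set xs \<subseteq> {..d}"
    proof
      fix x assume "x \<in> set xs"
      then have "x \<in># l" using xs by auto
      then have "x \<le> sum_mset l"
        using member_le_sum_list[of x xs] xs[symmetric] \<open>x \<in> set xs\<close>
        by (simp add: sum_mset_sum_list)
      then show "x \<in> {..d}" using p by simp
    qed
    moreover have "length xs \<le> d"
      using size_le_sum_mset[OF p(2)] p(3) xs by (auto simp: size_mset[symmetric] simp del: size_mset)
    ultimately show "p \<in> ?M \<times> {..d}" using p xs by auto
  qed
  moreover have "finite ?M"
    by (intro finite_imageI finite_lists_length_le) simp
  ultimately show ?thesis
    by (meson finite_SigmaI finite_atMost finite_subset)
qed

lemma sum_fun_apply: "(\<Sum>x\<in>S. f x) i = (\<Sum>x\<in>S. f x i)" for f :: "'b \<Rightarrow> 'i \<Rightarrow> rat"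
  by (induction S rule: infinite_finite_induct) auto

lemma partition_type_in:
  assumes "P \<in> set_partitions d" "0 < d"
  shows "partition_type d P \<in> ub_indices d"
proof -
  have P: "partition_on {1..d} P" using assms by (simp add: set_partitions_def)
  then have fin: "finite P" by (meson finite_elements finite_atLeastAtMost)
  have finB: "finite B" if "B \<in> P" for B
    using P that by (metis Union_upper finite_atLeastAtMost finite_subset partition_onD1)
  have ne: "B \<noteq> {}" if "B \<in> P" for B using P that by (auto simp: partition_on_def)
  have "\<exists>!B. B \<in> P \<and> d \<in> B"
  proof -
    have "d \<in> \<Union>P" using P assms(2) by (simp add: partition_on_def)
    then obtain B where B: "B \<in> P" "d \<in> B" by blast
    moreover have "C = B" if "C \<in> P" "d \<in> C" for C
      using P B that by (auto simp: partition_on_def disjoint_def)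
    ultimately show ?thesis by blast
  qed
  then have b: "block P d \<in> P" "d \<in> block P d"
    unfolding block_def by (metis (mono_tags, lifting) theI')+
  have "sum card P = card (\<Union>P)"
    using P finB by (intro card_Union_disjoint[symmetric]) (auto simp: partition_on_def disjoint_def pairwise_def disjnt_def)
  also have "\<dots> = d" using P by (simp add: partition_on_def)
  finally have "sum card (P - {block P d}) + card (block P d) = d"
    using b fin by (simp add: sum.remove[of P "block P d"])
  moreover have "0 \<notin># image_mset card (mset_set (P - {block P d}))"
    using fin finB ne by (auto simp: card_eq_0_iff)
  moreover have "0 < card (block P d)" using b finB by (auto simp: card_gt_0_iff)
  ultimately show ?thesis
    by (simp add: ub_indices_def partition_type_def sum_unfold_sum_mset)
qed

lemma nu_expansion:
  assumes "0 < d"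
  shows "nu d F = (\<Sum>p\<in>ub_indices d. fscale (nu d F p) (e_ub p))"
proof
  fix q
  have "nu d F q = 0" if "q \<notin> ub_indices d"
    using partition_type_in[OF _ assms] that
    by (auto simp: nu_def sum_fun_apply fscale_def e_ub_def intro!: sum.neutral)
  then show "nu d F q = (\<Sum>p\<in>ub_indices d. fscale (nu d F p) (e_ub p)) q"
    using finite_ub_indices[of d]
    by (auto simp: sum_fun_apply fscale_def e_ub_def if_distrib sum.delta cong: if_cong)
qed

end

theory Submission
  imports Defs "HOL-Library.Nat_Bijection"
begin

text \<open>For each \<open>v\<close> and \<open>j\<close>, the number of acyclic orientations with \<open>j\<close> sinks, one of them \<open>v\<close>,
  is a fixed linear combination of the coefficients of \<open>Y\<^sub>G\<close>, i.e. of the indicators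
  ``\<open>\<kappa>\<close> is a proper colouring of \<open>G\<close>''. To see this, let \<open>a(U)\<close> be the number of acyclic
  orientations of \<open>G[U]\<close>. Orientations of \<open>G[U]\<close> in which a stable set \<open>S\<close> consists of sinks
  correspond to orientations of \<open>G[U - S]\<close>, and every acyclic orientation has a sink, so
  inclusion-exclusion gives \<open>a(U) = \<Sum>\<^sub>S (-1)\<^bsup>|S|-1\<^esup> a(U - S)\<close> over the nonempty stable
  \<open>S \<subseteq> U\<close>; unfolding this recursion while giving every removed \<open>S\<close> a new colour ends
  in proper colourings of \<open>G\<close>.

  Now \<open>e\<^sub>\<pi>\<close> is itself \<open>Y\<^sub>K\<close> for the disjoint union \<open>K\<close> of cliques on the blocks of \<open>\<pi>\<close>,
  so the theorem reduces by linearity to these \<open>K\<close>. Each of their acyclic orientations has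
  exactly one sink in each clique, and those with sink \<open>v\<close> number \<open>\<lambda>! (b - 1)!\<close>. The same
  functional, applied to common refinements, also shows that the \<open>e\<^sub>\<pi>\<close> are linearly
  independent.\<close>


section \<open>Acyclic orientations and their sinks\<close>

text \<open>The edge condition of \<open>simple_graph\<close> on its own: the recursion below also
  reaches the empty vertex set.\<close>

definition edges_on :: "'a set \<Rightarrow> 'a set set \<Rightarrow> bool" where
  "edges_on V E \<longleftrightarrow> (\<forall>e\<in>E. \<exists>u w. e = {u, w} \<and> u \<in> V \<and> w \<in> V \<and> u \<noteq> w)"

definition induced_edges :: "'a set set \<Rightarrow> 'a set \<Rightarrow> 'a set set" where
  "induced_edges E U = {e \<in> E. e \<subseteq> U}"

definition acyclic_orientations :: "'a set set \<Rightarrow> 'a rel set" where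
  "acyclic_orientations E = {A. orientation E A \<and> acyclic A}"

text \<open>Colours have any type and need not be positive, and values off the graph are ignored.
  Later colourings take blocks or encoded pairs as colours.\<close>

definition proper :: "('a \<Rightarrow> 'b) \<Rightarrow> 'a set set \<Rightarrow> bool" where
  "proper \<kappa> E \<longleftrightarrow> (\<forall>u w. {u, w} \<in> E \<longrightarrow> \<kappa> u \<noteq> \<kappa> w)"

lemma edges_onD:
  assumes "edges_on V E" "{u, w} \<in> E"
  shows "u \<in> V" "w \<in> V" "u \<noteq> w"
  using assms by (fastforce simp: edges_on_def doubleton_eq_iff)+

lemma edges_onE:
  assumes "edges_on V E" "e \<in> E"
  obtains u w where "e = {u, w}" "u \<in> V" "w \<in> V" "u \<noteq> w"
  using assms unfolding edges_on_def by blast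

lemma edges_on_induced: "edges_on V E \<Longrightarrow> edges_on U (induced_edges E U)"
  by (fastforce simp: edges_on_def induced_edges_def)

lemma induced_edges_all: "edges_on V E \<Longrightarrow> induced_edges E V = E"
  by (fastforce simp: edges_on_def induced_edges_def)

lemma induced_edges_induced: "W \<subseteq> U \<Longrightarrow> induced_edges (induced_edges E U) W = induced_edges E W"
  by (auto simp: induced_edges_def)

lemma orientation_iff:
  assumes "orientation E A"
  shows "{u, w} \<in> E \<longleftrightarrow> (u, w) \<in> A \<or> (w, u) \<in> A"
proof -
  have "{a, b} \<in> E" if "(a, b) \<in> A" for a b
    using assms that by (auto simp: orientation_def)
  then show ?thesis using assms insert_commute[of u w "{}"] unfolding orientation_def by metis
qed

lemma orientation_subset:
  assumes "orientation E A" "edges_on V E"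
  shows "A \<subseteq> V \<times> V"
proof
  fix p assume "p \<in> A"
  then have "{fst p, snd p} \<in> E" using assms(1) by (auto simp: orientation_def)
  then show "p \<in> V \<times> V" using edges_onD[OF assms(2)] by (metis mem_Times_iff)
qed

lemma finite_acyclic_orientations:
  assumes "finite V" "edges_on V E"
  shows "finite (acyclic_orientations E)"
proof (rule finite_subset)
  show "acyclic_orientations E \<subseteq> Pow (V \<times> V)"
    using orientation_subset[OF _ assms(2)] unfolding acyclic_orientations_def by blast
  show "finite (Pow (V \<times> V))" using assms(1) by simp
qed

lemma acyclic_orientations_empty: "acyclic_orientations {} = {{}}"
  by (auto simp: acyclic_orientations_def orientation_def acyclic_def)

text \<open>A finite acyclic relation has a well-founded converse, so some element of
  \<open>C\<close> has no arc into \<open>C\<close>; closure under adjacency excludes arcs leaving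
  \<open>C\<close>. Applied to \<open>C\<close> the whole vertex set and to \<open>C\<close> a
  single clique.\<close>

lemma exists_sink_in:
  assumes "finite V" "edges_on V E" "A \<in> acyclic_orientations E" "C \<subseteq> V" "C \<noteq> {}"
    and "\<And>u w. u \<in> C \<Longrightarrow> {u, w} \<in> E \<Longrightarrow> w \<in> C"
  shows "sinks V A \<inter> C \<noteq> {}"
proof -
  have A: "orientation E A" "acyclic A" using assms by (auto simp: acyclic_orientations_def)
  have "finite A" using orientation_subset[OF A(1) assms(2)] assms(1)
    by (meson finite_SigmaI finite_subset)
  then have "wf (A\<inverse>)" using A(2) by (rule finite_acyclic_wf_converse)
  then obtain z where z: "z \<in> C" "\<And>y. (z, y) \<in> A \<Longrightarrow> y \<notin> C"
    using assms(5) by (metis converse_iff equals0I wfE_min)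
  then have "z \<in> sinks V A"
    using assms(4,6) orientation_iff[OF A(1)] by (auto simp: sinks_def)
  with z(1) show ?thesis by blast
qed

text \<open>No arc starts in \<open>S\<close>, so an arc of \<open>C\<close> can only be the last
  one of a path and lies on no cycle.\<close>

lemma acyclic_Un_into:
  assumes "acyclic B" "B \<subseteq> (- S) \<times> (- S)" "C \<subseteq> (- S) \<times> S"
  shows "acyclic (B \<union> C)"
proof -
  have "x \<notin> S \<and> (y \<in> S \<or> (x, y) \<in> B\<^sup>+)" if "(x, y) \<in> (B \<union> C)\<^sup>+" for x y
    using that
  proof (induction rule: trancl_induct)
    case (base y)
    then show ?case using assms by blast
  next
    case (step y z)
    then show ?case using assms(2,3) by (blast intro: trancl_into_trancl)
  qed
  then show ?thesis using assms(1) by (metis acyclic_def)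
qed

text \<open>An edge inside \<open>S\<close> would give one of its ends an outgoing arc. If
  \<open>S\<close> is stable, all edges between \<open>S\<close> and the rest are forced to point
  into \<open>S\<close>, so an orientation is determined by its restriction to \<open>U - S\<close>,
  and every acyclic one there extends.\<close>

lemma card_acyclic_orientations_sinks:
  assumes "edges_on U E" "S \<subseteq> U"
  shows "card {A \<in> acyclic_orientations E. S \<subseteq> sinks U A} =
    of_bool (induced_edges E S = {}) * card (acyclic_orientations (induced_edges E (U - S)))"
proof (cases "induced_edges E S = {}")
  case False
  then obtain u w where uw: "{u, w} \<in> E" "u \<in> S" "w \<in> S"
    using assms(1) by (fastforce simp: induced_edges_def edges_on_def)
  have "\<not> S \<subseteq> sinks U A" if "A \<in> acyclic_orientations E" for A
    using that uw orientation_iff[of E A u w] by (auto simp: acyclic_orientations_def sinks_def)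
  then have none: "{A \<in> acyclic_orientations E. S \<subseteq> sinks U A} = {}" by blast
  show ?thesis unfolding none using False by simp
next
  case True
  let ?W = "U - S"
  \<comment> \<open>The forced arcs into \<open>S\<close>.\<close>
  let ?C = "{(u, s). u \<in> ?W \<and> s \<in> S \<and> {u, s} \<in> E}"
  let ?X = "{A \<in> acyclic_orientations E. S \<subseteq> sinks U A}"
  let ?Y = "acyclic_orientations (induced_edges E ?W)"
  have stable: "{u, w} \<notin> E" if "u \<in> S" "w \<in> S" for u w
    using True that by (auto simp: induced_edges_def)
  note E = edges_onD[OF assms(1)]
  have "bij_betw (\<lambda>A. A \<inter> ?W \<times> ?W) ?X ?Y"
  proof (rule bij_betw_byWitness[where f' = "\<lambda>B. B \<union> ?C"])
    show "\<forall>A\<in>?X. (A \<inter> ?W \<times> ?W) \<union> ?C = A"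
    proof
      fix A assume "A \<in> ?X"
      then have A: "orientation E A" "S \<subseteq> sinks U A" by (auto simp: acyclic_orientations_def)
      have "(u, w) \<in> A \<longleftrightarrow> (u, w) \<in> (A \<inter> ?W \<times> ?W) \<union> ?C" for u w
        using A(2) orientation_iff[OF A(1), of u w] E[of u w] by (auto simp: sinks_def)
      then show "(A \<inter> ?W \<times> ?W) \<union> ?C = A" by (auto simp: set_eq_iff)
    qed
    have sub: "B \<subseteq> ?W \<times> ?W" if "B \<in> ?Y" for B
      using that orientation_subset[OF _ edges_on_induced[OF assms(1)]]
      by (auto simp: acyclic_orientations_def)
    show "\<forall>B\<in>?Y. (B \<union> ?C) \<inter> ?W \<times> ?W = B"
      using sub by blast
    show "(\<lambda>A. A \<inter> ?W \<times> ?W) ` ?X \<subseteq> ?Y"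
    proof clarify
      fix A assume A: "A \<in> acyclic_orientations E"
      then have "acyclic (A \<inter> ?W \<times> ?W)"
        by (auto simp: acyclic_orientations_def intro: acyclic_subset)
      moreover have "orientation (induced_edges E ?W) (A \<inter> ?W \<times> ?W)"
        using A by (auto simp: acyclic_orientations_def orientation_def induced_edges_def)
      ultimately show "A \<inter> ?W \<times> ?W \<in> ?Y" by (simp add: acyclic_orientations_def)
    qed
    show "(\<lambda>B. B \<union> ?C) ` ?Y \<subseteq> ?X"
    proof clarify
      fix B assume B: "B \<in> ?Y"
      note BW = sub[OF B]
      have oB: "orientation (induced_edges E ?W) B" and "acyclic B"
        using B by (auto simp: acyclic_orientations_def)
      then have "acyclic (B \<union> ?C)"
        using BW by (intro acyclic_Un_into[where S = S]) auto
      moreover have "orientation E (B \<union> ?C)"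
        unfolding orientation_def
      proof (intro conjI allI impI ballI)
        fix p assume "p \<in> B \<union> ?C"
        then show "case p of (u, w) \<Rightarrow> {u, w} \<in> E"
          using orientation_iff[OF oB] by (auto simp: induced_edges_def)
      next
        fix u w assume uw: "{u, w} \<in> E"
        then have wu: "{w, u} \<in> E" by (simp add: insert_commute)
        have "{u, w} \<in> induced_edges E ?W \<Longrightarrow> ((u, w) \<in> B) \<noteq> ((w, u) \<in> B)"
          using oB by (auto simp: orientation_def)
        then show "((u, w) \<in> B \<union> ?C) \<noteq> ((w, u) \<in> B \<union> ?C)"
          using E[OF uw] uw wu stable[of u w] BW
          by (cases "u \<in> S"; cases "w \<in> S") (auto simp: induced_edges_def)
      qed
      ultimately show "B \<union> ?C \<in> acyclic_orientations E \<and> S \<subseteq> sinks U (B \<union> ?C)"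
        using assms(2) BW by (auto simp: acyclic_orientations_def sinks_def)
    qed
  qed
  then have "card ?X = card ?Y" by (rule bij_betw_same_card)
  then show ?thesis using True by simp
qed

section \<open>Inclusion-exclusion over stable sets of sinks\<close>

lemma sum_neg_one_power_Pow:
  assumes "finite T" "T \<noteq> {}"
  shows "(\<Sum>S\<in>Pow T. (- 1) ^ card S) = (0 :: 'b :: comm_ring_1)"
proof -
  obtain x where x: "x \<in> T" using assms by blast
  define R where "R = T - {x}"
  have T: "T = insert x R" "x \<notin> R" "finite R" using x assms by (auto simp: R_def)
  have "(\<Sum>S\<in>Pow T. (- 1 :: 'b) ^ card S) =
      (\<Sum>S\<in>Pow R. (- 1) ^ card S) + (\<Sum>S\<in>insert x ` Pow R. (- 1) ^ card S)"
    unfolding T(1) Pow_insert using T(2,3) by (intro sum.union_disjoint) auto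
  also have "(\<Sum>S\<in>insert x ` Pow R. (- 1 :: 'b) ^ card S) = (\<Sum>S\<in>Pow R. (- 1) ^ card (insert x S))"
    using T(2) by (subst sum.reindex) (auto simp: inj_on_def)
  also have "\<dots> = (\<Sum>S\<in>Pow R. - ((- 1) ^ card S))"
    using T(2,3) finite_subset by (intro sum.cong refl, subst card_insert_disjoint) auto
  finally show ?thesis by (simp add: sum_negf)
qed

text \<open>The sink set of each acyclic orientation is nonempty, so the signed sum over its
  nonempty subsets is 1. Summing over the orientations and exchanging the sums leaves, for each
  \<open>S\<close>, the number of orientations in which \<open>S\<close> consists of sinks.\<close>

lemma card_acyclic_orientations_recursion:
  assumes "finite U" "U \<noteq> {}" "edges_on U E"
  shows "(of_nat (card (acyclic_orientations E)) :: rat) =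
    (\<Sum>S\<in>Pow U - {{}}. (- 1) ^ Suc (card S) * of_bool (induced_edges E S = {}) *
       of_nat (card (acyclic_orientations (induced_edges E (U - S)))))"
proof -
  let ?O = "acyclic_orientations E"
  have fO: "finite ?O" using assms by (intro finite_acyclic_orientations)
  have one: "(\<Sum>S\<in>Pow U - {{}}. (- 1) ^ Suc (card S) * of_bool (S \<subseteq> sinks U A)) = (1 :: rat)"
    if "A \<in> ?O" for A
  proof -
    have su: "sinks U A \<subseteq> U" by (auto simp: sinks_def)
    then have fs: "finite (sinks U A)" using assms(1) finite_subset by blast
    have "sinks U A \<noteq> {}"
      using exists_sink_in[OF assms(1,3) that, of U] assms(2) edges_onD[OF assms(3)] by blast
    then have "(\<Sum>S\<in>Pow (sinks U A). (- 1) ^ card S) = (0 :: rat)"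
      by (rule sum_neg_one_power_Pow[OF fs])
    then have "(\<Sum>S\<in>Pow (sinks U A) - {{}}. (- 1) ^ Suc (card S)) = (1 :: rat)"
      using fs by (simp add: sum_diff1 sum_negf)
    moreover have "(\<Sum>S\<in>Pow U - {{}}. (- 1) ^ Suc (card S) * of_bool (S \<subseteq> sinks U A)) =
        (\<Sum>S\<in>Pow (sinks U A) - {{}}. (- 1) ^ Suc (card S) :: rat)"
      using assms(1) su by (intro sum.mono_neutral_cong_right) auto
    ultimately show ?thesis by metis
  qed
  have "(of_nat (card ?O) :: rat) = (\<Sum>A\<in>?O. 1)" by simp
  also have "\<dots> = (\<Sum>A\<in>?O. \<Sum>S\<in>Pow U - {{}}. (- 1) ^ Suc (card S) * of_bool (S \<subseteq> sinks U A))"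
    using one by (intro sum.cong) simp_all
  also have "\<dots> = (\<Sum>S\<in>Pow U - {{}}. \<Sum>A\<in>?O. (- 1) ^ Suc (card S) * of_bool (S \<subseteq> sinks U A))"
    by (rule sum.swap)
  also have "\<dots> = (\<Sum>S\<in>Pow U - {{}}. (- 1) ^ Suc (card S) * of_nat (card {A \<in> ?O. S \<subseteq> sinks U A}))"
    using fO by (simp add: sum_distrib_left[symmetric] Int_def of_bool_def sum.If_cases del: power_Suc)
  also have "\<dots> = (\<Sum>S\<in>Pow U - {{}}. (- 1) ^ Suc (card S) * of_bool (induced_edges E S = {}) *
       of_nat (card (acyclic_orientations (induced_edges E (U - S)))))"
    using card_acyclic_orientations_sinks[OF assms(3)] by (intro sum.cong refl) auto
  finally show ?thesis .
qed

text \<open>As \<open>k\<close> is fresh, edges between \<open>S\<close> and the part already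
  coloured are never violated, whereas an edge inside \<open>S\<close> always is. Thus the stability
  condition of the recursion becomes part of properness.\<close>

lemma proper_recolour:
  assumes "edges_on V E" "S \<subseteq> U" "U \<subseteq> V" "\<And>u. u \<in> V \<Longrightarrow> \<kappa> u \<noteq> k"
  shows "proper (\<lambda>u. if u \<in> S then k else \<kappa> u) (induced_edges E (V - (U - S))) \<longleftrightarrow>
    proper \<kappa> (induced_edges E (V - U)) \<and> induced_edges E S = {}"
    (is "?L \<longleftrightarrow> ?R")
proof
  assume L: ?L
  have "proper \<kappa> (induced_edges E (V - U))"
    unfolding proper_def
  proof (intro allI impI)
    fix u w assume "{u, w} \<in> induced_edges E (V - U)"
    then have "{u, w} \<in> induced_edges E (V - (U - S))" "u \<notin> S" "w \<notin> S"
      using assms(2) by (auto simp: induced_edges_def)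
    then show "\<kappa> u \<noteq> \<kappa> w" using L unfolding proper_def by metis
  qed
  moreover have False if "e \<in> induced_edges E S" for e
  proof -
    have "e \<in> E" using that by (simp add: induced_edges_def)
    then obtain u w where e: "e = {u, w}" using edges_onE[OF assms(1)] by metis
    then have "{u, w} \<in> induced_edges E (V - (U - S))" "u \<in> S" "w \<in> S"
      using that assms(2,3) by (auto simp: induced_edges_def)
    then show False using L unfolding proper_def by metis
  qed
  ultimately show ?R by blast
next
  assume R: ?R
  show ?L
    unfolding proper_def
  proof (intro allI impI)
    fix u w assume uw: "{u, w} \<in> induced_edges E (V - (U - S))"
    then have V: "u \<in> V" "w \<in> V" "u \<notin> U - S" "w \<notin> U - S" "{u, w} \<in> E"
      by (auto simp: induced_edges_def)
    have "\<not> (u \<in> S \<and> w \<in> S)" using R V(5) by (auto simp: induced_edges_def)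
    moreover have "\<kappa> u \<noteq> \<kappa> w" if "u \<notin> S" "w \<notin> S"
      using that V R by (auto simp: induced_edges_def proper_def)
    ultimately show "(if u \<in> S then k else \<kappa> u) \<noteq> (if w \<in> S then k else \<kappa> w)"
      using assms(4) V(1,2) by (metis (full_types))
  qed
qed

lemma sinks_subset: "sinks V A \<subseteq> V"
  by (auto simp: sinks_def)

section \<open>Linear relations between colourings\<close>

context
  fixes V :: "'a set" and I :: "'i set" and a :: "'i \<Rightarrow> rat" and F :: "'i \<Rightarrow> 'a set set"
  assumes fin: "finite V" and edges: "\<And>i. i \<in> I \<Longrightarrow> edges_on V (F i)"
    and relation: "\<And>\<kappa> :: 'a \<Rightarrow> nat. (\<Sum>i\<in>I. a i * of_bool (proper \<kappa> (F i))) = 0"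
begin

text \<open>Interpolates between the assumed relation (\<open>U = {}\<close>) and a relation between numbers of
  acyclic orientations (\<open>U = V\<close>); the induction removes a stable set from \<open>U\<close> and
  paints it with an unused colour.\<close>

lemma relation_partially_coloured:
  assumes "U \<subseteq> V"
  shows "(\<Sum>i\<in>I. a i * (of_bool (proper (\<kappa> :: 'a \<Rightarrow> nat) (induced_edges (F i) (V - U))) *
    of_nat (card (acyclic_orientations (induced_edges (F i) U))))) = 0"
  using assms
proof (induction "card U" arbitrary: U \<kappa> rule: less_induct)
  case less
  have finU: "finite U" using less.prems fin finite_subset by blast
  show ?case
  proof (cases "U = {}")
    case True
    have "induced_edges (F i) {} = {}" if "i \<in> I" for i
      using edges[OF that] by (auto simp: induced_edges_def edges_on_def)
    then show ?thesis
      using True relation[of \<kappa>] edges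
      by (simp add: induced_edges_all acyclic_orientations_empty cong: sum.cong)
  next
    case False
    define k where "k = Suc (Max (\<kappa> ` V))"
    have k: "\<kappa> u \<noteq> k" if "u \<in> V" for u
    proof -
      have "\<kappa> u \<le> Max (\<kappa> ` V)" using that fin by (intro Max_ge) auto
      then show ?thesis by (simp add: k_def)
    qed
    define \<kappa>' where "\<kappa>' S = (\<lambda>u. if u \<in> S then k else \<kappa> u)" for S
    let ?p = "\<lambda>i \<kappa> U. of_bool (proper (\<kappa> :: 'a \<Rightarrow> nat) (induced_edges (F i) (V - U))) :: rat"
    let ?n = "\<lambda>i U. of_nat (card (acyclic_orientations (induced_edges (F i) U))) :: rat"
    \<comment> \<open>Expand \<open>?n i U\<close> by the recursion; the indicator that
      \<open>S\<close> is stable merges with \<open>?p i \<kappa> U\<close> into properness of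
      \<open>\<kappa>' S\<close>. The signs do not depend on \<open>i\<close>, so the sum over
      \<open>i\<close> can be moved inside and the induction hypothesis applied for each
      \<open>S\<close>.\<close>
    have "?p i \<kappa> U * ?n i U = (\<Sum>S\<in>Pow U - {{}}. (- 1) ^ Suc (card S) * (?p i (\<kappa>' S) (U - S) * ?n i (U - S)))"
      if "i \<in> I" for i
    proof -
      have "?n i U = (\<Sum>S\<in>Pow U - {{}}. (- 1) ^ Suc (card S) * of_bool (induced_edges (F i) S = {}) * ?n i (U - S))"
        unfolding card_acyclic_orientations_recursion[OF finU False edges_on_induced[OF edges[OF that]]]
        by (intro sum.cong refl) (auto simp: induced_edges_induced)
      then have "?p i \<kappa> U * ?n i U = (\<Sum>S\<in>Pow U - {{}}. (- 1) ^ Suc (card S) *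
          (?p i \<kappa> U * of_bool (induced_edges (F i) S = {}) * ?n i (U - S)))"
        by (simp add: sum_distrib_left mult_ac)
      also have "\<dots> = (\<Sum>S\<in>Pow U - {{}}. (- 1) ^ Suc (card S) * (?p i (\<kappa>' S) (U - S) * ?n i (U - S)))"
        using proper_recolour[where \<kappa> = \<kappa> and k = k, OF edges[OF that] _ less.prems k]
        by (intro sum.cong refl) (simp add: \<kappa>'_def of_bool_conj)
      finally show ?thesis .
    qed
    then have "(\<Sum>i\<in>I. a i * (?p i \<kappa> U * ?n i U)) =
        (\<Sum>i\<in>I. \<Sum>S\<in>Pow U - {{}}. (- 1) ^ Suc (card S) * (a i * (?p i (\<kappa>' S) (U - S) * ?n i (U - S))))"
      by (intro sum.cong refl) (simp add: sum_distrib_left mult.left_commute)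
    also have "\<dots> = (\<Sum>S\<in>Pow U - {{}}. (- 1) ^ Suc (card S) *
        (\<Sum>i\<in>I. a i * (?p i (\<kappa>' S) (U - S) * ?n i (U - S))))"
      by (subst sum.swap) (simp add: sum_distrib_left)
    also have "\<dots> = 0"
    proof (rule sum.neutral, rule ballI)
      fix S assume S: "S \<in> Pow U - {{}}"
      then have "U - S \<subset> U" by blast
      then have "card (U - S) < card U" using finU by (rule psubset_card_mono[rotated])
      then have "(\<Sum>i\<in>I. a i * (?p i (\<kappa>' S) (U - S) * ?n i (U - S))) = 0"
        using less.prems by (intro less.hyps) auto
      then show "(- 1) ^ Suc (card S) * (\<Sum>i\<in>I. a i * (?p i (\<kappa>' S) (U - S) * ?n i (U - S))) = 0"
        by simp
    qed
    finally show ?thesis .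
  qed
qed

text \<open>Take \<open>U = V - T\<close> and a constant colouring of \<open>T\<close>: it is proper
  exactly when \<open>T\<close> is stable, which is the factor in the count of orientations with all
  of \<open>T\<close> as sinks.\<close>

lemma relation_sinks_superset:
  assumes "T \<subseteq> V"
  shows "(\<Sum>i\<in>I. a i * of_nat (card {A \<in> acyclic_orientations (F i). T \<subseteq> sinks V A})) = 0"
proof -
  have "proper (\<lambda>_. 0 :: nat) (induced_edges (F i) T) \<longleftrightarrow> induced_edges (F i) T = {}" if "i \<in> I" for i
  proof
    assume p: "proper (\<lambda>_. 0 :: nat) (induced_edges (F i) T)"
    have False if e: "e \<in> induced_edges (F i) T" for e
    proof -
      obtain u w where "e = {u, w}" using edges_onE[OF edges_on_induced[OF edges[OF \<open>i \<in> I\<close>]] e] .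
      then show False using p e by (auto simp: proper_def)
    qed
    then show "induced_edges (F i) T = {}" by blast
  qed (simp add: proper_def)
  moreover have "V - (V - T) = T" using assms by blast
  ultimately show ?thesis
    using relation_partially_coloured[of "V - T" "\<lambda>_. 0"] assms
      card_acyclic_orientations_sinks[OF edges assms]
    by (simp cong: sum.cong)
qed

text \<open>Moebius inversion by induction from large sets to small: the relation for sink sets
  containing \<open>T\<close> is a sum over all \<open>W\<close> between \<open>T\<close> and
  \<open>V\<close>, and every term with \<open>W\<close> strictly larger vanishes already.\<close>

lemma relation_sinks_eq:
  assumes "T \<subseteq> V"
  shows "(\<Sum>i\<in>I. a i * of_nat (card {A \<in> acyclic_orientations (F i). sinks V A = T})) = 0"
  using assms
proof (induction "card (V - T)" arbitrary: T rule: less_induct)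
  case less
  let ?s = "\<lambda>T. \<Sum>i\<in>I. a i * of_nat (card {A \<in> acyclic_orientations (F i). sinks V A = T})"
  let ?D = "{W. T \<subseteq> W \<and> W \<subseteq> V}"
  have finD: "finite ?D" using fin by (auto intro: finite_subset[of _ "Pow V"])
  have split: "card {A \<in> acyclic_orientations (F i). T \<subseteq> sinks V A} =
      (\<Sum>W\<in>?D. card {A \<in> acyclic_orientations (F i). sinks V A = W})" if "i \<in> I" for i
  proof -
    have "{A \<in> acyclic_orientations (F i). T \<subseteq> sinks V A} =
        (\<Union>W\<in>?D. {A \<in> acyclic_orientations (F i). sinks V A = W})"
      using sinks_subset[of V] by auto
    then have "card {A \<in> acyclic_orientations (F i). T \<subseteq> sinks V A} =
        card (\<Union>W\<in>?D. {A \<in> acyclic_orientations (F i). sinks V A = W})"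
      by (rule arg_cong)
    also have "\<dots> = (\<Sum>W\<in>?D. card {A \<in> acyclic_orientations (F i). sinks V A = W})"
      using finD finite_acyclic_orientations[OF fin edges[OF that]]
      by (intro card_UN_disjoint) auto
    finally show ?thesis .
  qed
  have "0 = (\<Sum>i\<in>I. a i * of_nat (card {A \<in> acyclic_orientations (F i). T \<subseteq> sinks V A}))"
    using relation_sinks_superset[OF less.prems] by simp
  also have "\<dots> = (\<Sum>i\<in>I. \<Sum>W\<in>?D. a i * of_nat (card {A \<in> acyclic_orientations (F i). sinks V A = W}))"
    using split by (simp add: sum_distrib_left cong: sum.cong)
  also have "\<dots> = (\<Sum>W\<in>?D. ?s W)" by (rule sum.swap)
  also have "\<dots> = ?s T + (\<Sum>W\<in>?D - {T}. ?s W)"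
    using finD less.prems by (intro sum.remove) auto
  also have "(\<Sum>W\<in>?D - {T}. ?s W) = 0"
  proof (rule sum.neutral, rule ballI)
    fix W assume W: "W \<in> ?D - {T}"
    then have "card (V - W) < card (V - T)" using fin by (intro psubset_card_mono) auto
    then show "?s W = 0" using less.hyps[of W] W by simp
  qed
  finally show ?case by simp
qed

lemma relation_sink_at:
  "(\<Sum>i\<in>I. a i * of_nat (sink_at V (F i) v j)) = 0"
proof -
  let ?D = "{T. T \<subseteq> V \<and> v \<in> T \<and> card T = j}"
  have finD: "finite ?D" using fin by (auto intro: finite_subset[of _ "Pow V"])
  have "sink_at V (F i) v j = (\<Sum>T\<in>?D. card {A \<in> acyclic_orientations (F i). sinks V A = T})"
    if "i \<in> I" for i
  proof -
    have "sink_at V (F i) v j = card (\<Union>T\<in>?D. {A \<in> acyclic_orientations (F i). sinks V A = T})"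
      unfolding sink_at_def using sinks_subset[of V]
      by (intro arg_cong[of _ _ card]) (fastforce simp: acyclic_orientations_def)
    also have "\<dots> = (\<Sum>T\<in>?D. card {A \<in> acyclic_orientations (F i). sinks V A = T})"
      using finD finite_acyclic_orientations[OF fin edges[OF that]]
      by (intro card_UN_disjoint) auto
    finally show ?thesis .
  qed
  then have "(\<Sum>i\<in>I. a i * of_nat (sink_at V (F i) v j)) =
      (\<Sum>i\<in>I. \<Sum>T\<in>?D. a i * of_nat (card {A \<in> acyclic_orientations (F i). sinks V A = T}))"
    by (simp add: sum_distrib_left cong: sum.cong)
  also have "\<dots> = (\<Sum>T\<in>?D. \<Sum>i\<in>I. a i * of_nat (card {A \<in> acyclic_orientations (F i). sinks V A = T}))"
    by (rule sum.swap)
  also have "\<dots> = 0" using relation_sinks_eq by (intro sum.neutral) simp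
  finally show ?thesis .
qed

end

section \<open>Disjoint unions of cliques\<close>

text \<open>The partition is given by the fibres of a function, so that relabelling is composition
  and common refinement is pairing.\<close>

definition cliques :: "'a set \<Rightarrow> ('a \<Rightarrow> 'b) \<Rightarrow> 'a set set" where
  "cliques V g = {{u, w} | u w. u \<in> V \<and> w \<in> V \<and> u \<noteq> w \<and> g u = g w}"

lemma edges_on_cliques: "edges_on V (cliques V g)"
  by (auto simp: edges_on_def cliques_def)

lemma cliques_iff: "{u, w} \<in> cliques V g \<longleftrightarrow> u \<in> V \<and> w \<in> V \<and> u \<noteq> w \<and> g u = g w"
  by (auto simp: cliques_def doubleton_eq_iff)

lemma induced_edges_cliques: "U \<subseteq> V \<Longrightarrow> induced_edges (cliques V g) U = cliques U g"
  by (auto simp: induced_edges_def cliques_def)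

text \<open>Two sinks in one fibre would be adjacent, and each fibre is closed under adjacency,
  hence contains a sink.\<close>

lemma bij_betw_sinks_cliques:
  assumes "finite V" "A \<in> acyclic_orientations (cliques V g)"
  shows "bij_betw g (sinks V A) (g ` V)"
  unfolding bij_betw_def
proof
  have A: "orientation (cliques V g) A" using assms(2) by (simp add: acyclic_orientations_def)
  show "inj_on g (sinks V A)"
  proof (rule inj_onI, rule ccontr)
    fix u w assume "u \<in> sinks V A" "w \<in> sinks V A" "g u = g w" "u \<noteq> w"
    then show False
      using orientation_iff[OF A, of u w] by (auto simp: cliques_iff sinks_def)
  qed
  show "g ` sinks V A = g ` V"
  proof
    show "g ` V \<subseteq> g ` sinks V A"
    proof clarify
      fix u assume "u \<in> V"
      then have "sinks V A \<inter> {w \<in> V. g w = g u} \<noteq> {}"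
        by (intro exists_sink_in[OF assms(1) edges_on_cliques assms(2)]) (auto simp: cliques_iff)
      then obtain w where "w \<in> sinks V A" "g w = g u" by blast
      then show "g u \<in> g ` sinks V A" by (intro image_eqI[of _ _ w]) simp_all
    qed
  qed (auto simp: sinks_def)
qed

lemma card_acyclic_orientations_sink:
  assumes "v \<in> V"
  shows "card {A \<in> acyclic_orientations (cliques V g). v \<in> sinks V A} =
    card (acyclic_orientations (cliques (V - {v}) g))"
proof -
  have "induced_edges (cliques V g) {v} = {}" by (auto simp: induced_edges_def cliques_def)
  then show ?thesis
    using card_acyclic_orientations_sinks[OF edges_on_cliques, of "{v}" V g] assms
    by (simp add: induced_edges_cliques)
qed

text \<open>Classify by the unique sink in one clique \<open>C\<close>: each of the
  \<open>card C\<close> choices leaves the same problem with one vertex of \<open>C\<close> removed.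
  \<open>T\<close> may exceed the image of \<open>g\<close>, so it can stay fixed when a fibre
  becomes empty and contributes \<open>fact 0 = 1\<close>.\<close>

lemma card_acyclic_orientations_cliques:
  assumes "finite U" "finite T" "g ` U \<subseteq> T"
  shows "card (acyclic_orientations (cliques U g)) = (\<Prod>b\<in>T. fact (card {u \<in> U. g u = b}))"
  using assms
proof (induction "card U" arbitrary: U rule: less_induct)
  case less
  show ?case
  proof (cases "U = {}")
    case True
    then show ?thesis by (simp add: cliques_def acyclic_orientations_empty)
  next
    case False
    then obtain x where x: "x \<in> U" by blast
    define b where "b = g x"
    define C where "C = {u \<in> U. g u = b}"
    have C: "finite C" "C \<subseteq> U" "card C > 0" "b \<in> T"
      using x less.prems by (auto simp: C_def b_def card_gt_0_iff)
    let ?O = "acyclic_orientations (cliques U g)"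
    let ?R = "\<Prod>b'\<in>T - {b}. fact (card {u \<in> U. g u = b'}) :: nat"
    have fO: "finite ?O" using less.prems(1) edges_on_cliques by (rule finite_acyclic_orientations)
    have "?O = (\<Union>s\<in>C. {A \<in> ?O. s \<in> sinks U A})"
    proof -
      have "\<exists>s\<in>C. s \<in> sinks U A" if "A \<in> ?O" for A
      proof -
        have "b \<in> g ` sinks U A"
          using bij_betw_sinks_cliques[OF less.prems(1) that] x by (auto simp: bij_betw_def b_def)
        then show ?thesis using sinks_subset by (fastforce simp: C_def)
      qed
      then show ?thesis by blast
    qed
    then have "card ?O = card (\<Union>s\<in>C. {A \<in> ?O. s \<in> sinks U A})" by metis
    also have "\<dots> = (\<Sum>s\<in>C. card {A \<in> ?O. s \<in> sinks U A})"
    proof (rule card_UN_disjoint)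
      have "s = t" if "A \<in> ?O" "s \<in> sinks U A" "t \<in> sinks U A" "s \<in> C" "t \<in> C" for A s t
        using bij_betw_sinks_cliques[OF less.prems(1) that(1)] that
        by (auto simp: bij_betw_def C_def inj_on_def)
      then show "\<forall>s\<in>C. \<forall>t\<in>C. s \<noteq> t \<longrightarrow> {A \<in> ?O. s \<in> sinks U A} \<inter> {A \<in> ?O. t \<in> sinks U A} = {}"
        by blast
    qed (use C fO in auto)
    also have "\<dots> = (\<Sum>s\<in>C. fact (card C - 1) * ?R)"
    proof (rule sum.cong)
      fix s assume s: "s \<in> C"
      then have sU: "s \<in> U" "g s = b" by (auto simp: C_def)
      have "card {A \<in> ?O. s \<in> sinks U A} = (\<Prod>b'\<in>T. fact (card {u \<in> U - {s}. g u = b'}))"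
        unfolding card_acyclic_orientations_sink[OF sU(1)]
        using less.prems sU card_Diff1_less[of U s] by (intro less.hyps) auto
      also have "\<dots> = fact (card {u \<in> U - {s}. g u = b}) * (\<Prod>b'\<in>T - {b}. fact (card {u \<in> U - {s}. g u = b'}))"
        using less.prems C by (intro prod.remove) auto
      also have "{u \<in> U - {s}. g u = b} = C - {s}" by (auto simp: C_def)
      also have "(\<Prod>b'\<in>T - {b}. fact (card {u \<in> U - {s}. g u = b'})) = ?R"
        using sU by (intro prod.cong refl arg_cong[of _ _ fact] arg_cong[of _ _ card]) auto
      finally show "card {A \<in> ?O. s \<in> sinks U A} = fact (card C - 1) * ?R"
        using s C by simp
    qed simp
    also have "\<dots> = fact (card C) * ?R"
      using C(3) by (simp add: fact_reduce)
    also have "\<dots> = (\<Prod>b\<in>T. fact (card {u \<in> U. g u = b}))"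
      using less.prems C by (simp add: prod.remove[of T b] C_def)
    finally show ?thesis .
  qed
qed

lemma sink_at_cliques:
  assumes "finite V" "v \<in> V"
  shows "sink_at V (cliques V g) v j =
    (if j = card (g ` V) then \<Prod>b\<in>g ` V. fact (card {u \<in> V - {v}. g u = b}) else 0)"
proof -
  have card: "card (sinks V A) = card (g ` V)" if "A \<in> acyclic_orientations (cliques V g)" for A
    using bij_betw_sinks_cliques[OF assms(1) that] by (rule bij_betw_same_card)
  have "sink_at V (cliques V g) v j =
      card {A \<in> acyclic_orientations (cliques V g). card (sinks V A) = j \<and> v \<in> sinks V A}"
    by (simp add: sink_at_def acyclic_orientations_def)
  also have "\<dots> = (if j = card (g ` V)
      then card {A \<in> acyclic_orientations (cliques V g). v \<in> sinks V A} else 0)"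
    using card by (auto simp: card_eq_0_iff intro!: arg_cong[of _ _ card])
  also have "card {A \<in> acyclic_orientations (cliques V g). v \<in> sinks V A} =
      (\<Prod>b\<in>g ` V. fact (card {u \<in> V - {v}. g u = b}))"
    unfolding card_acyclic_orientations_sink[OF assms(2)]
    using assms(1) by (intro card_acyclic_orientations_cliques) auto
  finally show ?thesis .
qed

section \<open>The basis of elementary functions\<close>

lemma proper_cong:
  assumes "edges_on V E" "\<And>u w. u \<in> V \<Longrightarrow> w \<in> V \<Longrightarrow> \<kappa> u = \<kappa> w \<longleftrightarrow> \<kappa>' u = \<kappa>' w"
  shows "proper \<kappa> E \<longleftrightarrow> proper \<kappa>' E"
  unfolding proper_def using edges_onD[OF assms(1)] assms(2) by metis

lemma proper_image:
  assumes "edges_on V E"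
  shows "proper \<kappa> ((`) f ` E) \<longleftrightarrow> proper (\<kappa> \<circ> f) E"
proof
  assume L: "proper \<kappa> ((`) f ` E)"
  show "proper (\<kappa> \<circ> f) E"
    unfolding proper_def
  proof (intro allI impI)
    fix u w assume "{u, w} \<in> E"
    then have "f ` {u, w} \<in> (`) f ` E" by (rule imageI)
    then show "(\<kappa> \<circ> f) u \<noteq> (\<kappa> \<circ> f) w" using L by (simp add: proper_def)
  qed
next
  assume R: "proper (\<kappa> \<circ> f) E"
  show "proper \<kappa> ((`) f ` E)"
    unfolding proper_def
  proof (intro allI impI)
    fix x y assume "{x, y} \<in> (`) f ` E"
    then obtain e where e: "e \<in> E" "{x, y} = f ` e" by blast
    obtain u w where uw: "e = {u, w}" using edges_onE[OF assms e(1)] by metis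
    then have "\<kappa> (f u) \<noteq> \<kappa> (f w)" using R e(1) by (simp add: proper_def)
    moreover have "x = f u \<and> y = f w \<or> x = f w \<and> y = f u"
      using e(2) uw by (auto simp: doubleton_eq_iff)
    ultimately show "\<kappa> x \<noteq> \<kappa> y" by auto
  qed
qed

lemma edges_on_image:
  assumes "edges_on V E" "inj_on f V"
  shows "edges_on (f ` V) ((`) f ` E)"
  unfolding edges_on_def
proof
  fix e' assume "e' \<in> (`) f ` E"
  then obtain e where e: "e \<in> E" "e' = f ` e" by blast
  obtain u w where uw: "e = {u, w}" "u \<in> V" "w \<in> V" "u \<noteq> w" using edges_onE[OF assms(1) e(1)] .
  then have "f u \<noteq> f w" using assms(2) by (auto simp: inj_on_def)
  moreover have "e' = {f u, f w}" using uw(1) e(2) by simp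
  ultimately show "\<exists>x y. e' = {x, y} \<and> x \<in> f ` V \<and> y \<in> f ` V \<and> x \<noteq> y"
    using uw by blast
qed

lemma image_cliques:
  assumes "inj_on f V"
  shows "(`) f ` cliques V (g \<circ> f) = cliques (f ` V) g"
proof (intro equalityI subsetI)
  fix e assume "e \<in> (`) f ` cliques V (g \<circ> f)"
  then obtain u w where "e = {f u, f w}" "u \<in> V" "w \<in> V" "u \<noteq> w" "g (f u) = g (f w)"
    by (auto simp: cliques_def)
  then show "e \<in> cliques (f ` V) g"
    using assms by (auto simp: cliques_iff inj_on_def)
next
  fix e assume "e \<in> cliques (f ` V) g"
  then obtain u w where uw: "e = {f u, f w}" "u \<in> V" "w \<in> V" "f u \<noteq> f w" "g (f u) = g (f w)"
    by (auto simp: cliques_def)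
  then have "{u, w} \<in> cliques V (g \<circ> f)" by (auto simp: cliques_iff)
  then have "f ` {u, w} \<in> (`) f ` cliques V (g \<circ> f)" by (rule imageI)
  then show "e \<in> (`) f ` cliques V (g \<circ> f)" using uw(1) by simp
qed

section \<open>Coefficients of chromatic series\<close>

definition positive_word :: "nat \<Rightarrow> nat list \<Rightarrow> bool" where
  "positive_word d w \<longleftrightarrow> length w = d \<and> set w \<subseteq> {0<..}"

text \<open>Positions count from 1, so that \<open>letter w\<close> is the word read as a colouring
  of \<open>{1..d}\<close>.\<close>

definition letter :: "nat list \<Rightarrow> nat \<Rightarrow> nat" where
  "letter w i = w ! (i - 1)"

lemma letter_map: "i \<in> {1..d} \<Longrightarrow> letter (map \<kappa> [1..<Suc d]) i = \<kappa> i"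
  unfolding letter_def by (subst nth_map) (auto simp del: upt_Suc)

lemma map_letter: "length w = d \<Longrightarrow> map (letter w) [1..<Suc d] = w"
  by (intro nth_equalityI) (auto simp: letter_def simp del: upt_Suc)

text \<open>Colourings are extensional, so a word comes from at most one of them, the restriction of
  \<open>letter w\<close>; the coefficients are 0 or 1.\<close>

lemma chromatic_nc_eq:
  assumes "edges_on {1..d} E"
  shows "chromatic_nc d E w = of_bool (positive_word d w \<and> proper (letter w) E)"
proof (cases "positive_word d w \<and> proper (letter w) E")
  case True
  let ?\<kappa> = "restrict (letter w) {1..d}"
  have "{\<kappa> \<in> proper_colourings {1..d} E. map \<kappa> [1..<Suc d] = w} = {?\<kappa>}"
  proof (intro equalityI subsetI)
    fix \<kappa> assume \<kappa>: "\<kappa> \<in> {\<kappa> \<in> proper_colourings {1..d} E. map \<kappa> [1..<Suc d] = w}"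
    then have "\<kappa> i = letter w i" if "i \<in> {1..d}" for i
      using letter_map[OF that, of \<kappa>] by simp
    then have "\<kappa> = ?\<kappa>"
      using \<kappa> by (intro ext) (auto simp: proper_colourings_def PiE_def extensional_def)
    then show "\<kappa> \<in> {?\<kappa>}" by simp
  next
    fix \<kappa> assume \<kappa>: "\<kappa> \<in> {?\<kappa>}"
    have "letter w i > 0" if "i \<in> {1..d}" for i
    proof -
      have "letter w i \<in> set w" using that True by (auto simp: letter_def positive_word_def)
      then show ?thesis using True by (auto simp: positive_word_def)
    qed
    moreover have "?\<kappa> u \<noteq> ?\<kappa> x" if "{u, x} \<in> E" for u x
      using edges_onD[OF assms that] True that by (auto simp: proper_def)
    ultimately have "?\<kappa> \<in> proper_colourings {1..d} E"
      by (auto simp: proper_colourings_def)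
    moreover have "map ?\<kappa> [1..<Suc d] = map (letter w) [1..<Suc d]"
      by (intro map_cong) auto
    then have "map ?\<kappa> [1..<Suc d] = w"
      using map_letter[of w d] True by (simp only: positive_word_def)
    ultimately show "\<kappa> \<in> {\<kappa> \<in> proper_colourings {1..d} E. map \<kappa> [1..<Suc d] = w}"
      using \<kappa> by blast
  qed
  then have "card {\<kappa> \<in> proper_colourings {1..d} E. map \<kappa> [1..<Suc d] = w} = 1" by simp
  then show ?thesis using True by (simp only: chromatic_nc_def) simp
next
  case False
  have "positive_word d w \<and> proper (letter w) E"
    if "\<kappa> \<in> proper_colourings {1..d} E" "map \<kappa> [1..<Suc d] = w" for \<kappa>
  proof
    show "positive_word d w"
      using that by (force simp: positive_word_def proper_colourings_def simp del: upt_Suc)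
    have "proper \<kappa> E" using that(1) by (simp add: proper_colourings_def proper_def)
    then show "proper (letter w) E"
      using letter_map[of _ d \<kappa>] that(2)
      by (subst (asm) proper_cong[OF assms, where \<kappa>' = "letter w"]) auto
  qed
  then have "{\<kappa> \<in> proper_colourings {1..d} E. map \<kappa> [1..<Suc d] = w} = {}" using False by blast
  then have "card {\<kappa> \<in> proper_colourings {1..d} E. map \<kappa> [1..<Suc d] = w} = 0" by (simp only: card.empty)
  then show ?thesis using False by (simp only: chromatic_nc_def) simp
qed

lemma e_nc_eq_chromatic_nc: "e_nc d P = chromatic_nc d (cliques {1..d} (block P))"
proof
  fix w
  have "proper (letter w) (cliques {1..d} (block P)) \<longleftrightarrow>
      (\<forall>j\<in>{1..d}. \<forall>k\<in>{1..d}. j \<noteq> k \<and> block P j = block P k \<longrightarrow> w ! (j - 1) \<noteq> w ! (k - 1))"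
    unfolding proper_def letter_def cliques_iff by blast
  then show "e_nc d P w = chromatic_nc d (cliques {1..d} (block P)) w"
    unfolding chromatic_nc_eq[OF edges_on_cliques] e_nc_def positive_word_def by auto
qed

lemma chromatic_nc_relation_proper:
  fixes \<kappa> :: "nat \<Rightarrow> nat"
  assumes "\<And>i. i \<in> I \<Longrightarrow> edges_on {1..d} (F i)"
    and "\<And>w. (\<Sum>i\<in>I. a i * chromatic_nc d (F i) w) = 0"
  shows "(\<Sum>i\<in>I. a i * of_bool (proper \<kappa> (F i))) = 0"
proof -
  \<comment> \<open>\<open>Suc\<close> makes the colours positive without changing which of them
    agree.\<close>
  let ?w = "map (Suc \<circ> \<kappa>) [1..<Suc d]"
  have w: "positive_word d ?w" by (auto simp: positive_word_def simp del: upt_Suc)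
  have "proper (letter ?w) (F i) \<longleftrightarrow> proper \<kappa> (F i)" if "i \<in> I" for i
    using letter_map[of _ d "Suc \<circ> \<kappa>"] by (intro proper_cong[OF assms(1)[OF that]]) auto
  then have "a i * of_bool (proper \<kappa> (F i)) = a i * chromatic_nc d (F i) ?w" if "i \<in> I" for i
    using chromatic_nc_eq[OF assms(1)[OF that], of ?w] w that by simp
  then have "(\<Sum>i\<in>I. a i * of_bool (proper \<kappa> (F i))) = (\<Sum>i\<in>I. a i * chromatic_nc d (F i) ?w)"
    by (intro sum.cong refl)
  then show ?thesis using assms(2) by metis
qed

section \<open>Blocks of set partitions\<close>

lemma block_eqI:
  assumes "partition_on A P" "B \<in> P" "i \<in> B"
  shows "block P i = B"
  unfolding block_def
proof (rule the_equality)
  fix C assume "C \<in> P \<and> i \<in> C"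
  then show "C = B" using assms by (auto simp: partition_on_def disjoint_def)
qed (use assms in simp)

lemma block_in:
  assumes "partition_on A P" "i \<in> A"
  shows "block P i \<in> P" "i \<in> block P i"
proof -
  obtain B where "B \<in> P" "i \<in> B" using assms by (auto simp: partition_on_def)
  then show "block P i \<in> P" "i \<in> block P i" using block_eqI[OF assms(1)] by metis+
qed

lemma block_eq_class:
  assumes "partition_on A P" "i \<in> A"
  shows "block P i = {k \<in> A. block P k = block P i}"
proof (intro equalityI subsetI)
  fix k assume k: "k \<in> block P i"
  then have "k \<in> A" using block_in[OF assms] assms(1) by (auto simp: partition_on_def)
  then show "k \<in> {k \<in> A. block P k = block P i}"
    using block_eqI[OF assms(1) block_in(1)[OF assms] k] by simp
qed (use block_in[OF assms(1)] in auto)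

lemma block_image:
  assumes "partition_on A P"
  shows "block P ` A = P"
proof (intro equalityI subsetI)
  fix B assume B: "B \<in> P"
  then have "B \<noteq> {}" using assms by (auto simp: partition_on_def)
  then obtain i where i: "i \<in> B" by blast
  then have "i \<in> A" using B assms by (auto simp: partition_on_def)
  then show "B \<in> block P ` A" using block_eqI[OF assms B i] by blast
qed (auto intro: block_in(1)[OF assms])

lemma partition_eq_if_blocks_agree:
  assumes "partition_on A P" "partition_on A Q"
    and "\<And>i k. i \<in> A \<Longrightarrow> k \<in> A \<Longrightarrow> block P i = block P k \<longleftrightarrow> block Q i = block Q k"
  shows "P = Q"
proof -
  have "block P i = block Q i" if "i \<in> A" for i
  proof -
    have "block P i = {k \<in> A. block P k = block P i}" by (rule block_eq_class[OF assms(1) that])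
    also have "\<dots> = {k \<in> A. block Q k = block Q i}" using assms(3) that by blast
    also have "\<dots> = block Q i" by (rule block_eq_class[OF assms(2) that, symmetric])
    finally show ?thesis .
  qed
  then have "block P ` A = block Q ` A" by (rule image_cong[OF refl])
  then show ?thesis using block_image assms(1,2) by metis
qed

section \<open>Linear independence of the elementary functions\<close>

lemma finite_set_partitions: "finite (set_partitions d)"
  by (simp add: set_partitions_def finitely_many_partition_on)

text \<open>If a colour also records \<open>h\<close>, then edges between different fibres of \<open>h\<close> impose no
  condition.\<close>

lemma common_refinement_relation:
  fixes h :: "'a \<Rightarrow> 'c"
  assumes "\<And>\<kappa> :: 'a \<Rightarrow> nat. (\<Sum>i\<in>I. a i * of_bool (proper \<kappa> (cliques V (g i)))) = (0 :: rat)"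
    and "finite V"
  shows "(\<Sum>i\<in>I. a i * of_bool (proper (\<kappa> :: 'a \<Rightarrow> nat) (cliques V (\<lambda>u. (g i u, h u))))) = 0"
proof -
  have "finite (h ` V)" using assms(2) by simp
  then obtain n :: "'c \<Rightarrow> nat" where "inj_on n (h ` V)"
    using finite_imp_inj_to_nat_seg by metis
  \<comment> \<open>The new colour encodes the pair of the old colour and a number identifying the
    fibre of \<open>h\<close>.\<close>
  then have "prod_encode (\<kappa> u, n (h u)) = prod_encode (\<kappa> w, n (h w)) \<longleftrightarrow> \<kappa> u = \<kappa> w \<and> h u = h w"
    if "u \<in> V" "w \<in> V" for u w
    using that by (auto simp: inj_on_def)
  then have "proper (\<lambda>u. prod_encode (\<kappa> u, n (h u))) (cliques V (g i)) \<longleftrightarrow>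
      proper \<kappa> (cliques V (\<lambda>u. (g i u, h u)))" for i
    unfolding proper_def cliques_iff prod.inject by blast
  then show ?thesis using assms(1)[of "\<lambda>u. prod_encode (\<kappa> u, n (h u))"] by simp
qed

text \<open>Among the partitions with nonzero coefficient let \<open>R\<close> have fewest blocks, and refine all
  of them by \<open>R\<close>. Orientations of the resulting clique unions have as many sinks as there are
  blocks, so those with \<open>card R\<close> sinks exist only for partitions coarser than \<open>R\<close>, that is,
  only for \<open>R\<close> itself.\<close>

lemma e_nc_relation_trivial:
  assumes "0 < d" "\<And>w. (\<Sum>P\<in>set_partitions d. a P * e_nc d P w) = 0" "Q \<in> set_partitions d"
  shows "a Q = 0"
proof (rule ccontr)
  let ?V = "{1..d}"
  let ?N = "{P \<in> set_partitions d. a P \<noteq> 0}"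
  assume "a Q \<noteq> 0"
  then have "Q \<in> ?N" using assms(3) by blast
  then obtain R where R: "R \<in> ?N" "\<And>P. P \<in> ?N \<Longrightarrow> card R \<le> card P"
    using ex_has_least_nat[of "\<lambda>P. P \<in> ?N" Q card] by blast
  have part: "partition_on ?V P" if "P \<in> set_partitions d" for P
    using that by (simp add: set_partitions_def)
  let ?g = "\<lambda>P i. (block P i, block R i)"
  let ?s = "\<lambda>P. sink_at ?V (cliques ?V (?g P)) d (card R)"
  have "(\<Sum>P\<in>set_partitions d. a P * of_bool (proper (\<kappa> :: nat \<Rightarrow> nat) (cliques ?V (block P)))) = 0" for \<kappa>
    using assms(2) by (intro chromatic_nc_relation_proper[where d = d] edges_on_cliques)
      (simp add: e_nc_eq_chromatic_nc)
  then have "(\<Sum>P\<in>set_partitions d. a P * of_bool (proper (\<kappa> :: nat \<Rightarrow> nat) (cliques ?V (?g P)))) = 0" for \<kappa>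
    by (rule common_refinement_relation) simp
  then have relation: "(\<Sum>P\<in>set_partitions d. a P * of_nat (?s P)) = 0"
    by (intro relation_sink_at edges_on_cliques) auto
  have other: "a P * of_nat (?s P) = 0" if P: "P \<in> set_partitions d" "P \<noteq> R" for P
  proof (rule ccontr)
    assume nz: "a P * of_nat (?s P) \<noteq> 0"
    then have le: "card R \<le> card P" using R(2) P by auto
    have "?s P \<noteq> 0" using nz by auto
    then have eq: "card R = card (?g P ` ?V)"
      using assms(1) by (auto simp: sink_at_cliques split: if_splits)
    define X where "X = ?g P ` ?V"
    have X: "finite X" "card R = card X" using eq by (simp_all add: X_def)
    have imgs: "fst ` X = P" "snd ` X = R"
      using block_image[OF part] P(1) R(1) by (simp_all add: X_def image_image)
    \<comment> \<open>\<open>X\<close> is the set of blocks of the refinement. It projects onto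
      \<open>P\<close>, so \<open>card P \<le> card X = card R \<le> card P\<close>; both
      projections are therefore bijective.\<close>
    have "card X = card P"
      using le X imgs(1) card_image_le[of X fst] by simp
    then have inj_fst: "inj_on fst X"
      using X(1) imgs(1) by (intro eq_card_imp_inj_on) simp_all
    have inj_snd: "inj_on snd X"
      using X imgs(2) by (intro eq_card_imp_inj_on) simp_all
    have "block P i = block P k \<longleftrightarrow> block R i = block R k" if "i \<in> ?V" "k \<in> ?V" for i k
    proof -
      have X: "(block P i, block R i) \<in> X" "(block P k, block R k) \<in> X"
        unfolding X_def using that by (simp_all add: rev_image_eqI)
      show ?thesis
      proof
        assume "block P i = block P k"
        then show "block R i = block R k" using inj_onD[OF inj_fst _ X] by simp
      next
        assume "block R i = block R k"
        then show "block P i = block P k" using inj_onD[OF inj_snd _ X] by simp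
      qed
    qed
    then have "P = R"
      using R(1) by (intro partition_eq_if_blocks_agree[OF part part] P(1)) simp_all
    then show False using P(2) by simp
  qed
  have "(\<Sum>P\<in>set_partitions d - {R}. a P * of_nat (?s P)) = 0"
    using other by (intro sum.neutral) simp
  then have "a R * of_nat (?s R) = 0"
    using R(1) relation by (subst (asm) sum.remove[of _ R]) (simp_all add: finite_set_partitions)
  \<comment> \<open>Refining \<open>R\<close> by itself changes nothing: the pairs are diagonal and
    the number of blocks is \<open>card R\<close>.\<close>
  moreover have "?s R > 0"
  proof -
    have "snd ` ?g R ` ?V = R" using block_image[OF part] R(1) by (simp add: image_image)
    moreover have "inj_on snd (?g R ` ?V)" by (auto simp: inj_on_def)
    ultimately have "card (?g R ` ?V) = card R" by (metis card_image)
    then show ?thesis using assms(1) by (simp add: sink_at_cliques prod_pos)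
  qed
  ultimately show False using R(1) by simp
qed

text \<open>A coincidence would be a relation with coefficients 1 and -1. Injectivity lets sums over
  the set of basis vectors be reindexed by partitions.\<close>

lemma inj_on_e_nc:
  assumes "0 < d"
  shows "inj_on (e_nc d) (set_partitions d)"
proof (rule inj_onI, rule ccontr)
  fix P Q assume PQ: "P \<in> set_partitions d" "Q \<in> set_partitions d" "e_nc d P = e_nc d Q" "P \<noteq> Q"
  let ?a = "\<lambda>R. (if R = P then 1 else if R = Q then - 1 else 0 :: rat)"
  have "?a P = 0"
  proof (rule e_nc_relation_trivial[where a = ?a, OF assms _ PQ(1)])
    fix w
    have "(\<Sum>R\<in>set_partitions d. ?a R * e_nc d R w) = (\<Sum>R\<in>{P, Q}. ?a R * e_nc d R w)"
      using PQ finite_set_partitions[of d] by (intro sum.mono_neutral_right) auto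
    then show "(\<Sum>R\<in>set_partitions d. ?a R * e_nc d R w) = 0" using PQ by simp
  qed
  then show False by simp
qed

lemma independent_e_nc:
  assumes "0 < d"
  shows "fvec.independent (e_nc d ` set_partitions d)"
proof (rule fvec.independent_if_scalars_zero)
  fix r x
  assume r: "(\<Sum>x\<in>e_nc d ` set_partitions d. fscale (r x) x) = 0" and "x \<in> e_nc d ` set_partitions d"
  then obtain P where P: "P \<in> set_partitions d" "x = e_nc d P" by blast
  have "r (e_nc d P) = 0"
  proof (rule e_nc_relation_trivial[where a = "\<lambda>P. r (e_nc d P)", OF assms _ P(1)])
    fix w
    have "(\<Sum>P\<in>set_partitions d. fscale (r (e_nc d P)) (e_nc d P)) w = 0"
      using r by (simp add: sum.reindex[OF inj_on_e_nc[OF assms]])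
    then show "(\<Sum>P\<in>set_partitions d. r (e_nc d P) * e_nc d P w) = 0"
      by (simp add: sum_fun_apply fscale_def)
  qed
  then show "r x = 0" using P(2) by simp
qed (simp add: finite_set_partitions)

section \<open>Monomial functions and the span of the elementary functions\<close>

definition kernel :: "nat \<Rightarrow> nat list \<Rightarrow> nat set set" where
  "kernel d w = (\<lambda>i. {k \<in> {1..d}. letter w k = letter w i}) ` {1..d}"

text \<open>The monomial symmetric function in noncommuting variables.\<close>

definition m_nc :: "nat \<Rightarrow> nat set set \<Rightarrow> ncseries" where
  "m_nc d P = (\<lambda>w. of_bool (positive_word d w \<and> kernel d w = P))"

lemma kernel_in: "kernel d w \<in> set_partitions d"
  unfolding set_partitions_def
proof (rule CollectI, rule partition_onI)
  show "\<Union> (kernel d w) = {1..d}" by (auto simp: kernel_def)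
  show "disjnt p q" if "p \<in> kernel d w" "q \<in> kernel d w" "p \<noteq> q" for p q
    using that by (auto simp: kernel_def disjnt_def)
  show "{} \<notin> kernel d w" by (fastforce simp: kernel_def)
qed

lemma block_kernel:
  assumes "i \<in> {1..d}"
  shows "block (kernel d w) i = {k \<in> {1..d}. letter w k = letter w i}"
  using kernel_in[of d w] assms
  by (intro block_eqI[of "{1..d}"]) (auto simp: set_partitions_def kernel_def)

text \<open>Whether \<open>letter w\<close> is proper depends only on which letters agree, so the
  blocks of the kernel can serve as the colours.\<close>

lemma chromatic_nc_in_span_m_nc:
  assumes "edges_on {1..d} E"
  shows "chromatic_nc d E \<in> fvec.span (m_nc d ` set_partitions d)"
proof -
  have expansion: "chromatic_nc d E = (\<Sum>P\<in>set_partitions d. fscale (of_bool (proper (block P) E)) (m_nc d P))"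
  proof
    fix w
    have "proper (letter w) E \<longleftrightarrow> proper (block (kernel d w)) E"
      by (rule proper_cong[OF assms]) (auto simp: block_kernel)
    then show "chromatic_nc d E w =
        (\<Sum>P\<in>set_partitions d. fscale (of_bool (proper (block P) E)) (m_nc d P)) w"
      using kernel_in[of d w] finite_set_partitions[of d]
      by (simp add: chromatic_nc_eq[OF assms] sum_fun_apply fscale_def m_nc_def of_bool_conj
          sum.remove[of _ "kernel d w"])
  qed
  show ?thesis
    unfolding expansion by (intro fvec.span_sum fvec.span_scale fvec.span_base imageI)
qed

text \<open>There are no more \<open>m_nc\<close> than \<open>e_nc\<close>, so the independence of the latter makes the two spans
  equal.\<close>

lemma chromatic_nc_in_span_e_nc:
  assumes "0 < d" "edges_on {1..d} E"
  shows "chromatic_nc d E \<in> fvec.span (e_nc d ` set_partitions d)"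
proof -
  let ?e = "e_nc d ` set_partitions d" and ?m = "m_nc d ` set_partitions d"
  have fin: "finite ?e" "finite ?m" by (simp_all add: finite_set_partitions)
  have "?e \<subseteq> fvec.span ?m"
    using chromatic_nc_in_span_m_nc[OF edges_on_cliques] by (auto simp: e_nc_eq_chromatic_nc)
  have card_e: "card ?e = card (set_partitions d)" by (rule card_image[OF inj_on_e_nc[OF assms(1)]])
  have "?m \<subseteq> fvec.span ?e"
  proof (rule ccontr)
    assume "\<not> ?m \<subseteq> fvec.span ?e"
    \<comment> \<open>Adjoining \<open>x\<close> would give an independent set in the span of
      \<open>?m\<close> with more elements than \<open>?m\<close>.\<close>
    then obtain x where x: "x \<in> ?m" "x \<notin> fvec.span ?e" by blast
    then have "fvec.independent (insert x ?e)" "x \<notin> ?e"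
      using independent_e_nc[OF assms(1)] by (auto simp: fvec.independent_insert fvec.span_base)
    moreover have "insert x ?e \<subseteq> fvec.span ?m"
      using x(1) \<open>?e \<subseteq> fvec.span ?m\<close> fvec.span_base by blast
    ultimately have "card (insert x ?e) \<le> card ?m"
      using fvec.independent_span_bound[OF fin(2)] by blast
    then show False
      using \<open>x \<notin> ?e\<close> fin card_e card_image_le[OF finite_set_partitions, of "m_nc d" d] by simp
  qed
  then have "fvec.span ?m \<subseteq> fvec.span ?e" by (rule fvec.span_minimal) (rule fvec.subspace_span)
  then show ?thesis using chromatic_nc_in_span_m_nc[OF assms(2)] by blast
qed

section \<open>Sinks and types, and the theorem\<close>

text \<open>There is one sink per block, hence one more than the parts of the partition in the type.
  Prescribing the sink \<open>v\<close>, labelled \<open>d\<close>, removes one vertex from the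
  block of \<open>d\<close> only, which turns its factor into \<open>fact (b - 1)\<close>.\<close>

lemma sink_at_cliques_partition:
  assumes f: "bij_betw f V {1..d}" "f v = d" and v: "v \<in> V" and P: "P \<in> set_partitions d"
  shows "sink_at V (cliques V (block P \<circ> f)) v j =
    (if size (fst (partition_type d P)) + 1 = j
     then mfact (fst (partition_type d P)) * fact (snd (partition_type d P) - 1) else 0)"
proof -
  have part: "partition_on {1..d} P" using P by (simp add: set_partitions_def)
  have "finite V" using f(1) by (meson bij_betw_finite finite_atLeastAtMost)
  have d: "d \<in> {1..d}" using f v by (metis bij_betwE)
  note root = block_in[OF part d]
  have finP: "finite P" using part by (meson finite_elements finite_atLeastAtMost)
  have im: "(block P \<circ> f) ` V = P"
    using f(1) block_image[OF part] by (metis bij_betw_imp_surj_on image_comp)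
  have size: "size (fst (partition_type d P)) + 1 = card P"
    using card_Suc_Diff1[OF finP root(1)] by (simp add: partition_type_def)
  have card: "card {u \<in> V - {v}. (block P \<circ> f) u = B} = card (B - {d})" if B: "B \<in> P" for B
  proof -
    have inj: "inj_on f V" using f(1) by (rule bij_betw_imp_inj_on)
    have sub: "B \<subseteq> f ` V" using B part f(1) by (auto simp: partition_on_def bij_betw_def)
    have mem: "block P (f u) = B \<longleftrightarrow> f u \<in> B" if "u \<in> V" for u
    proof
      have "f u \<in> {1..d}" using f(1) that by (rule bij_betwE[rule_format])
      then show "f u \<in> B" if "block P (f u) = B" using block_in(2)[OF part] that by blast
      show "block P (f u) = B" if "f u \<in> B" using block_eqI[OF part B that] .
    qed
    have "f ` {u \<in> V - {v}. (block P \<circ> f) u = B} = B - {d}"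
    proof (intro equalityI subsetI)
      fix x assume "x \<in> f ` {u \<in> V - {v}. (block P \<circ> f) u = B}"
      then obtain u where u: "x = f u" "u \<in> V" "u \<noteq> v" "block P (f u) = B" by auto
      then have "f u \<noteq> d" using inj f(2) v by (metis inj_onD)
      then show "x \<in> B - {d}" using u mem by simp
    next
      fix x assume x: "x \<in> B - {d}"
      then obtain u where u: "x = f u" "u \<in> V" using sub by blast
      then have "u \<in> {u \<in> V - {v}. (block P \<circ> f) u = B}" using x f(2) mem by auto
      then show "x \<in> f ` {u \<in> V - {v}. (block P \<circ> f) u = B}" using u(1) by blast
    qed
    moreover have "inj_on f {u \<in> V - {v}. (block P \<circ> f) u = B}"
      using inj by (rule inj_on_subset) auto
    ultimately show ?thesis by (metis card_image)
  qed
  have "(\<Prod>B\<in>P. fact (card {u \<in> V - {v}. (block P \<circ> f) u = B})) = (\<Prod>B\<in>P. fact (card (B - {d})) :: nat)"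
    using card by (intro prod.cong) simp_all
  also have "\<dots> = fact (card (block P d - {d})) * (\<Prod>B\<in>P - {block P d}. fact (card (B - {d})))"
    using finP root(1) by (rule prod.remove)
  also have "(\<Prod>B\<in>P - {block P d}. fact (card (B - {d})) :: nat) = (\<Prod>B\<in>P - {block P d}. fact (card B))"
  proof (intro prod.cong refl)
    fix B assume B: "B \<in> P - {block P d}"
    then have "d \<notin> B" using block_eqI[OF part, of B d] by blast
    then show "fact (card (B - {d})) = (fact (card B) :: nat)" by simp
  qed
  also have "\<dots> = mfact (fst (partition_type d P))"
    by (simp add: mfact_def partition_type_def prod_unfold_prod_mset multiset.map_comp comp_def)
  also have "card (block P d - {d}) = snd (partition_type d P) - 1"
    using root(2) by (simp add: partition_type_def)
  finally show ?thesis
    unfolding sink_at_cliques[OF \<open>finite V\<close> v] im size by (simp add: mult.commute)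
qed

theorem theorem8p3:
  fixes V :: "'a set" and E :: "'a set set" and v :: 'a and f :: "'a \<Rightarrow> nat"
    and c :: "nat multiset \<times> nat \<Rightarrow> rat" and j :: nat
  assumes "simple_graph V E" and "v \<in> V"
    and "rooted_labelling V v f"
    and "y_labelled (card V) ((`) f ` E) =
           (\<Sum>(l, b)\<in>ub_indices (card V). fscale (c (l, b)) (e_ub (l, b)))"
    and "0 < j"
  shows "of_nat (sink_at V E v j) =
           (\<Sum>(l, b)\<in>{(l, b). (l, b) \<in> ub_indices (card V) \<and> size l + 1 = j}.
              c (l, b) * of_nat (mfact l) * fact (b - 1))"
proof -
  define d where "d = card V"
  have finV: "finite V" and EV: "edges_on V E"
    using assms(1) by (auto simp: simple_graph_def edges_on_def)
  have d: "0 < d" using finV assms(2) by (auto simp: d_def card_gt_0_iff)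
  have f: "bij_betw f V {1..d}" "f v = d"
    using assms(3) by (simp_all add: rooted_labelling_def d_def)
  then have inj: "inj_on f V" and im: "f ` V = {1..d}" by (simp_all add: bij_betw_def)
  let ?\<Pi> = "set_partitions d" and ?E' = "(`) f ` E"
  \<comment> \<open>The same coordinates as in the definition of \<open>nu\<close>.\<close>
  define a where "a P = fvec.representation (e_nc d ` ?\<Pi>) (chromatic_nc d ?E') (e_nc d P)" for P
  \<comment> \<open>\<open>None\<close> is the graph itself, \<open>Some P\<close> the clique union of \<open>e_nc d P\<close> pulled back to \<open>V\<close>.\<close>
  define F where "F i = (case i of None \<Rightarrow> E | Some P \<Rightarrow> cliques V (block P \<circ> f))" for i
  \<comment> \<open>The coefficient -1 turns the expansion of the chromatic series into a vanishing
    combination.\<close>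
  define a' where "a' i = (case i of None \<Rightarrow> - 1 | Some P \<Rightarrow> a P)" for i
  have F: "F None = E" "F (Some P) = cliques V (block P \<circ> f)"
    and a': "a' None = - 1" "a' (Some P) = a P" for P
    by (simp_all add: F_def a'_def)
  let ?I = "insert None (Some ` ?\<Pi>)"
  have sum_I: "(\<Sum>i\<in>?I. h i) = h None + (\<Sum>P\<in>?\<Pi>. h (Some P))" for h :: "nat set set option \<Rightarrow> rat"
    by (subst sum.insert) (auto simp: finite_set_partitions sum.reindex)
  have edges': "edges_on {1..d} ?E'" using edges_on_image[OF EV inj] im by simp
  have image_cl: "(`) f ` cliques V (block P \<circ> f) = cliques {1..d} (block P)" for P
    using image_cliques[OF inj] im by simp
  have expansion: "(\<Sum>P\<in>?\<Pi>. fscale (a P) (e_nc d P)) = chromatic_nc d ?E'"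
    using fvec.sum_representation_eq[OF independent_e_nc[OF d] chromatic_nc_in_span_e_nc[OF d edges'],
        of "e_nc d ` ?\<Pi>"]
    by (simp add: finite_set_partitions sum.reindex[OF inj_on_e_nc[OF d]] a_def)
  have edges'': "edges_on {1..d} ((`) f ` F i)" for i
    using edges' by (cases i) (simp_all add: F image_cl edges_on_cliques)
  have edges: "edges_on V (F i)" for i
    using EV by (cases i) (simp_all add: F edges_on_cliques)
  have "(\<Sum>i\<in>?I. a' i * chromatic_nc d ((`) f ` F i) w) = 0" for w
    using fun_cong[OF expansion, of w]
    by (simp add: sum_I F a' image_cl e_nc_eq_chromatic_nc sum_fun_apply fscale_def)
  then have "(\<Sum>i\<in>?I. a' i * of_bool (proper (\<kappa> :: nat \<Rightarrow> nat) ((`) f ` F i))) = 0" for \<kappa>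
    using edges'' by (rule chromatic_nc_relation_proper[rotated])
  then have proper_f: "(\<Sum>i\<in>?I. a' i * of_bool (proper (\<kappa> \<circ> f) (F i))) = 0" for \<kappa> :: "nat \<Rightarrow> nat"
    unfolding proper_image[OF edges] .
  \<comment> \<open>Every colouring of \<open>V\<close> is, up to its values off \<open>V\<close>,
    the pullback along \<open>f\<close> of one on labels; this moves the relation from
    \<open>{1..d}\<close> to \<open>V\<close>.\<close>
  have proper_inv: "proper (\<kappa> \<circ> inv_into V f \<circ> f) (F i) \<longleftrightarrow> proper \<kappa> (F i)" for \<kappa> :: "'a \<Rightarrow> nat" and i
    using inj by (intro proper_cong[OF edges]) simp
  have "(\<Sum>i\<in>?I. a' i * of_bool (proper (\<kappa> :: 'a \<Rightarrow> nat) (F i))) = 0" for \<kappa>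
    using proper_f[of "\<kappa> \<circ> inv_into V f"] unfolding proper_inv .
  then have "(\<Sum>i\<in>?I. a' i * of_nat (sink_at V (F i) v j)) = 0"
    using edges by (intro relation_sink_at[OF finV]) auto
  then have sink: "of_nat (sink_at V E v j) =
      (\<Sum>P\<in>?\<Pi>. a P * of_nat (sink_at V (cliques V (block P \<circ> f)) v j))"
    by (simp add: sum_I F a')

  let ?W = "\<lambda>p :: nat multiset \<times> nat. of_nat (mfact (fst p)) * fact (snd p - 1) :: rat"
  let ?J = "{p \<in> ub_indices d. size (fst p) + 1 = j}"
  have finJ: "finite ?J" using finite_ub_indices by simp
  \<comment> \<open>Comparing coefficients at \<open>p\<close>: \<open>nu\<close> collects in
    \<open>c p\<close> the coordinates of all partitions of type \<open>p\<close>.\<close>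
  have c: "c p = (\<Sum>P\<in>?\<Pi>. a P * of_bool (p = partition_type d P))" if "p \<in> ub_indices d" for p
  proof -
    have "y_labelled d ?E' p = (\<Sum>q\<in>ub_indices d. c q * of_bool (p = q))"
      using assms(4) by (simp add: d_def sum_fun_apply fscale_def e_ub_def case_prod_beta of_bool_def)
    also have "\<dots> = c p"
      using that finite_ub_indices[of d] by (simp add: of_bool_def if_distrib sum.delta cong: if_cong)
    finally show ?thesis
      by (simp add: y_labelled_def nu_def sum_fun_apply fscale_def e_ub_def a_def of_bool_def)
  qed
  have "(\<Sum>p\<in>?J. c p * ?W p) = (\<Sum>p\<in>?J. \<Sum>P\<in>?\<Pi>. a P * (of_bool (p = partition_type d P) * ?W p))"
    using c by (simp add: sum_distrib_right mult.assoc)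
  also have "\<dots> = (\<Sum>P\<in>?\<Pi>. a P * (\<Sum>p\<in>?J. of_bool (p = partition_type d P) * ?W p))"
    by (subst sum.swap) (simp add: sum_distrib_left)
  also have "\<dots> = (\<Sum>P\<in>?\<Pi>. a P * of_nat (sink_at V (cliques V (block P \<circ> f)) v j))"
  proof (intro sum.cong refl arg_cong2[of _ _ _ _ "(*)"])
    fix P assume P: "P \<in> ?\<Pi>"
    let ?t = "partition_type d P"
    have "(\<Sum>p\<in>?J. of_bool (p = ?t) * ?W p) = (\<Sum>p\<in>?J. if p = ?t then ?W p else 0)"
      by (intro sum.cong refl) simp
    \<comment> \<open>Only the type of \<open>P\<close> survives. It is always an index, so
      membership in \<open>?J\<close> amounts to the condition on the number of parts.\<close>
    also have "\<dots> = (if ?t \<in> ?J then ?W ?t else 0)"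
      using finJ by (simp only: sum.delta)
    finally show "(\<Sum>p\<in>?J. of_bool (p = ?t) * ?W p) =
        of_nat (sink_at V (cliques V (block P \<circ> f)) v j)"
      unfolding sink_at_cliques_partition[OF f assms(2) P]
      using partition_type_in[OF P d] by simp
  qed
  also have "\<dots> = of_nat (sink_at V E v j)" using sink by simp
  finally have "of_nat (sink_at V E v j) = (\<Sum>p\<in>?J. c p * ?W p)" by simp
  also have "\<dots> = (\<Sum>(l, b)\<in>{(l, b). (l, b) \<in> ub_indices (card V) \<and> size l + 1 = j}.
      c (l, b) * of_nat (mfact l) * fact (b - 1))"
    by (intro sum.cong) (auto simp: d_def mult.assoc)
  finally show ?thesis .
qed

end
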